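(* Let $\widehat S$ be a subgroup of $\widehat M$. Then $\widehat S$ is a Neumann subgroup of $\widehat M$ if and only if $\widehat S$ is a Cayley representation of the distant graph $\Gamma_{\mathbb Z}$ of $\mathbb P(\mathbb Z)$.
   Context: Let $\widehat M$ be the extended modular group, i.e. the group of all maps $z\mapsto \frac{az+b}{cz+d}$ with $a,b,c,d\in\mathbb Z$, $ad-bc=\pm1$, acting on $\overline{\mathbb Q}=\mathbb Q\cup\{\infty\}$ (with the usual conventions for $\infty$); it is identified with $PGL(2,\mathbb Z)=GL(2,\mathbb Z)/\{\pm I\}$. A subgroup $\widehat S\subset\widehat M$ is a Neumann subgroup of $\widehat M$ if for every $r\in\overline{\mathbb Q}$ there exists exactly one $\alpha\in\widehat S$ with $\alpha(\infty)=r$. The distant graph $\Gamma_{\mathbb Z}$ is the undirected graph whose vertex set is the projective line $\mathbb P(\mathbb Z)$, i.e. the set of cyclic submodules of $\mathbb Z^2$ generated by vectors with coprime coordinates (equivalently, vectors $\pm(a,c)$ with $\gcd(a,c)=1$, identified with $a/c\in\overline{\mathbb Q}$, where $\pm(1,0)$ corresponds to $\infty$). Two vertices $\pm(a,c)$ and $\pm(b,d)$ are adjacent if and only if $ad-bc=\pm1$. The group $\widehat M$ acts on $\Gamma_{\mathbb Z}$ by graph automorphisms. For a group $H$ and a generating set $\mathcal G\subset H\setminus\{1\}$ with $\mathcal G=\mathcal G^{-1}$, the Cayley graph of $(H,\mathcal G)$ has vertex set $H$ and edges $\{\alpha,\alpha g\}$ for $\alpha\in H$, $g\in\mathcal G$.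 A subgroup $\widehat S\subset \widehat M$, regarded as a group of automorphisms of $\Gamma_{\mathbb Z}$, is called a Cayley representation of $\Gamma_{\mathbb Z}$ if there are a generating set $\mathcal G=\mathcal G^{-1}\subset\widehat S\setminus\{1\}$ and a graph isomorphism $\varphi$ from the Cayley graph of $(\widehat S,\mathcal G)$ onto $\Gamma_{\mathbb Z}$ that is equivariant, i.e. $\varphi(\alpha\beta)=\alpha\,\varphi(\beta)$ for all $\alpha,\beta\in\widehat S$. *)

theory Defs
  imports Complex_Main "HOL-Algebra.Generated_Groups"
begin

text \<open>The rational projective line \<open>\<rat> \<union> {\<infinity>}\<close> is the type \<^typ>\<open>rat option\<close>, with \<^term>\<open>None\<close> for \<open>\<infinity>\<close>.\<close>

fun moebius :: "int \<Rightarrow> int \<Rightarrow> int \<Rightarrow> int \<Rightarrow> rat option \<Rightarrow> rat option" where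
  "moebius a b c d None = (if c = 0 then None else Some (of_int a / of_int c))"
| "moebius a b c d (Some z) =
     (if of_int c * z + of_int d = 0 then None
      else Some ((of_int a * z + of_int b) / (of_int c * z + of_int d)))"

definition ext_modular_group :: "(rat option \<Rightarrow> rat option) monoid" where
  "ext_modular_group =
     \<lparr>carrier = {moebius a b c d | a b c d. \<bar>a * d - b * c\<bar> = 1}, mult = (\<circ>), one = id\<rparr>"

definition neumann_subgroup :: "(rat option \<Rightarrow> rat option) set \<Rightarrow> bool" where
  "neumann_subgroup S \<longleftrightarrow>
     subgroup S ext_modular_group \<and> (\<forall>r. \<exists>!\<alpha>. \<alpha> \<in> S \<and> \<alpha> None = r)"

text \<open>An undirected graph is a pair of a vertex set and a set of edges \<open>{x, y}\<close>.\<close>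

type_synonym 'a ugraph = "'a set \<times> 'a set set"

definition graph_iso :: "('a \<Rightarrow> 'b) \<Rightarrow> 'a ugraph \<Rightarrow> 'b ugraph \<Rightarrow> bool" where
  "graph_iso \<phi> G H \<longleftrightarrow>
     bij_betw \<phi> (fst G) (fst H) \<and>
     (\<forall>x \<in> fst G. \<forall>y \<in> fst G. {x, y} \<in> snd G \<longleftrightarrow> {\<phi> x, \<phi> y} \<in> snd H)"

definition cayley_graph :: "('a, 'm) monoid_scheme \<Rightarrow> 'a set \<Rightarrow> 'a ugraph" where
  "cayley_graph H \<G> =
     (carrier H, {{\<alpha>, \<alpha> \<otimes>\<^bsub>H\<^esub> g} | \<alpha> g. \<alpha> \<in> carrier H \<and> g \<in> \<G>})"

definition cyclic_submodule :: "int \<times> int \<Rightarrow> (int \<times> int) set" where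
  "cyclic_submodule v = range (\<lambda>k. (k * fst v, k * snd v))"

definition projective_line_Z :: "(int \<times> int) set set" where
  "projective_line_Z = {cyclic_submodule (a, c) | a c. coprime a c}"

definition distant_graph :: "(int \<times> int) set ugraph" where
  "distant_graph =
     (projective_line_Z,
      {{cyclic_submodule (a, c), cyclic_submodule (b, d)} | a b c d.
         coprime a c \<and> coprime b d \<and> \<bar>a * d - b * c\<bar> = 1})"

text \<open>
  The identification of \<open>\<rat> \<union> {\<infinity>}\<close> with the projective line over the integers:
  \<open>a/c\<close> in lowest terms corresponds to the submodule generated by \<open>(a, c)\<close>,
  and \<open>\<infinity>\<close> to the one generated by \<open>(1, 0)\<close>.
\<close>

fun proj_point :: "rat option \<Rightarrow> (int \<times> int) set" where
  "proj_point None = cyclic_submodule (1, 0)"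
| "proj_point (Some q) = cyclic_submodule (quotient_of q)"

text \<open>
  The action on the vertices of the distant graph is transported along this identification;
  by \<open>vertex_action_moebius\<close> below it is the linear action of the matrix on submodules.
\<close>

definition vertex_action ::
    "(rat option \<Rightarrow> rat option) \<Rightarrow> (int \<times> int) set \<Rightarrow> (int \<times> int) set" where
  "vertex_action \<alpha> v = proj_point (\<alpha> (inv_into UNIV proj_point v))"

definition cayley_representation :: "(rat option \<Rightarrow> rat option) set \<Rightarrow> bool" where
  "cayley_representation S \<longleftrightarrow>
     subgroup S ext_modular_group \<and>
     (let H = ext_modular_group\<lparr>carrier := S\<rparr> in
      \<exists>\<G> \<phi>. \<G> \<subseteq> S - {\<one>\<^bsub>H\<^esub>} \<and> (\<lambda>g. inv\<^bsub>H\<^esub> g) ` \<G> = \<G> \<and> generate H \<G> = S \<and>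
        graph_iso \<phi> (cayley_graph H \<G>) distant_graph \<and>
        (\<forall>\<alpha> \<in> S. \<forall>\<beta> \<in> S. \<phi> (\<alpha> \<otimes>\<^bsub>H\<^esub> \<beta>) = vertex_action \<alpha> (\<phi> \<beta>)))"

definition slope :: "int \<Rightarrow> int \<Rightarrow> rat option" where
  "slope a c = (if c = 0 then None else Some (of_int a / of_int c))"

lemma slope_surj: "\<exists>a c. coprime a c \<and> r = slope a c \<and> proj_point r = cyclic_submodule (a, c)"
proof (cases r)
  case None
  then show ?thesis by (intro exI[of _ 1] exI[of _ 0]) (simp add: slope_def)
next
  case (Some q)
  obtain a c where q: "quotient_of q = (a, c)" by force
  have "c > 0" "coprime a c" "q = of_int a / of_int c"
    using quotient_of_denom_pos[OF q] quotient_of_coprime[OF q] quotient_of_div[OF q] by auto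
  then show ?thesis using Some q by (intro exI[of _ a] exI[of _ c]) (auto simp: slope_def)
qed

lemma cyclic_submodule_minus: "cyclic_submodule (- a, - c) = cyclic_submodule (a, c)"
proof -
  have "\<exists>l. k * - a = l * a \<and> k * - c = l * c" "\<exists>l. k * a = l * - a \<and> k * c = l * - c" for k
    by (rule exI[of _ "- k"], simp)+
  then show ?thesis unfolding cyclic_submodule_def by (auto simp: image_iff)
qed

lemma coprime_same_ratio:
  fixes a b c d :: int
  assumes "coprime a c" "coprime b d" "a * d = b * c"
  shows "a = b \<and> c = d \<or> a = - b \<and> c = - d"
proof -
  have "a dvd b" "b dvd a" "c dvd d" "d dvd c"
  proof -
    have "a dvd b * c" "b dvd a * d" "c dvd a * d" "d dvd b * c"
      using assms(3) by (metis dvd_triv_left dvd_triv_right)+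
    then show "a dvd b" "b dvd a" "c dvd d" "d dvd c"
      using assms(1,2) by (simp_all add: coprime_dvd_mult_left_iff coprime_dvd_mult_right_iff
          coprime_commute)
  qed
  then have "\<bar>a\<bar> = \<bar>b\<bar>" "\<bar>c\<bar> = \<bar>d\<bar>" by (blast intro: zdvd_antisym_abs)+
  then have "a = b \<or> a = - b" "c = d \<or> c = - d" by linarith+
  moreover have "a = 0 \<Longrightarrow> \<bar>c\<bar> = 1" "c = 0 \<Longrightarrow> \<bar>a\<bar> = 1" using assms by auto
  ultimately show ?thesis using assms(3) by auto
qed

lemma slope_eq_iff:
  assumes "coprime a c" "coprime b d"
  shows "slope a c = slope b d \<longleftrightarrow> a * d = b * c"
proof -
  have "slope a c = slope b d \<longleftrightarrow> (of_int (a * d) :: rat) = of_int (b * c)"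
    using assms by (auto simp: slope_def frac_eq_eq simp flip: of_int_mult)
  then show ?thesis by (simp only: of_int_eq_iff)
qed

lemma proj_point_slope:
  assumes "coprime a c"
  shows "proj_point (slope a c) = cyclic_submodule (a, c)"
proof -
  obtain b d where *: "coprime b d" "slope a c = slope b d"
    "proj_point (slope a c) = cyclic_submodule (b, d)" using slope_surj by blast
  then have "a = b \<and> c = d \<or> a = - b \<and> c = - d"
    using assms coprime_same_ratio slope_eq_iff by blast
  then show ?thesis using * cyclic_submodule_minus by auto
qed

lemma bij_betw_proj_point: "bij_betw proj_point UNIV projective_line_Z"
proof -
  have "inj proj_point"
  proof (rule injI)
    fix r s assume eq: "proj_point r = proj_point s"
    obtain a c where r: "coprime a c" "r = slope a c" "proj_point r = cyclic_submodule (a, c)"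
      using slope_surj by blast
    obtain b d where s: "coprime b d" "s = slope b d" "proj_point s = cyclic_submodule (b, d)"
      using slope_surj by blast
    have "(a, c) \<in> cyclic_submodule (a, c)"
      unfolding cyclic_submodule_def by (rule range_eqI[of _ _ 1]) simp
    then obtain k where "a = k * b" "c = k * d"
      using eq r s unfolding cyclic_submodule_def by auto
    then have "a * d = b * c" by simp
    then show "r = s" using slope_eq_iff r s by blast
  qed
  moreover have "range proj_point = projective_line_Z"
  proof
    show "range proj_point \<subseteq> projective_line_Z"
      using slope_surj unfolding projective_line_Z_def by blast
    show "projective_line_Z \<subseteq> range proj_point"
    proof
      fix v assume "v \<in> projective_line_Z"
      then obtain a c where "coprime a c" "v = cyclic_submodule (a, c)"
        by (auto simp: projective_line_Z_def)
      then have "v = proj_point (slope a c)" by (simp add: proj_point_slope)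
      then show "v \<in> range proj_point" by (rule range_eqI)
    qed
  qed
  ultimately show ?thesis by (simp add: bij_betw_def)
qed

lemma coprime_linear_image:
  fixes a b c d x y :: int
  assumes "\<bar>a * d - b * c\<bar> = 1" "coprime x y"
  shows "coprime (a * x + b * y) (c * x + d * y)"
proof (rule coprimeI)
  fix k assume k: "k dvd a * x + b * y" "k dvd c * x + d * y"
  have "k dvd d * (a * x + b * y) - b * (c * x + d * y)"
    "k dvd a * (c * x + d * y) - c * (a * x + b * y)" using k by (simp_all add: dvd_diff)
  then have "k dvd (a * d - b * c) * x" "k dvd (a * d - b * c) * y" by (simp_all add: algebra_simps)
  moreover have "a * d - b * c = 1 \<or> a * d - b * c = - 1" using assms(1) by linarith
  ultimately have "k dvd x" "k dvd y" by auto
  then show "is_unit k" using assms(2) coprime_common_divisor by blast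
qed

lemma moebius_slope:
  assumes "\<bar>a * d - b * c\<bar> = 1" "coprime x y"
  shows "moebius a b c d (slope x y) = slope (a * x + b * y) (c * x + d * y)"
proof (cases "y = 0")
  case True
  then show ?thesis using assms by (auto simp: slope_def)
next
  case False
  have e: "of_int u * (of_int x / of_int y) + of_int v = (of_int (u * x + v * y) :: rat) / of_int y"
    for u v using False by (simp add: field_simps)
  have z: "(of_int c * (of_int x / of_int y) + of_int d = (0 :: rat)) = (c * x + d * y = 0)"
    using False unfolding e by (simp del: of_int_add of_int_mult)
  have q: "(of_int a * (of_int x / of_int y) + of_int b) / (of_int c * (of_int x / of_int y) + of_int d)
      = (of_int (a * x + b * y) / of_int (c * x + d * y) :: rat)"
    using False unfolding e by (simp del: of_int_add of_int_mult)
  have "moebius a b c d (slope x y) = moebius a b c d (Some (of_int x / of_int y))"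
    using False by (simp add: slope_def)
  then show ?thesis unfolding moebius.simps z q by (simp only: slope_def)
qed

lemma vertex_action_moebius:
  assumes "\<bar>a * d - b * c\<bar> = 1" "coprime x y"
  shows "vertex_action (moebius a b c d) (cyclic_submodule (x, y)) =
    cyclic_submodule (a * x + b * y, c * x + d * y)"
proof -
  have "inv_into UNIV proj_point (cyclic_submodule (x, y)) = slope x y"
    using bij_betw_imp_inj_on[OF bij_betw_proj_point] proj_point_slope[OF assms(2)]
    by (metis inv_f_f)
  then show ?thesis
    by (simp add: vertex_action_def moebius_slope[OF assms]
        proj_point_slope[OF coprime_linear_image[OF assms]])
qed

lemma moebius_comp:
  assumes "\<bar>a * d - b * c\<bar> = 1" "\<bar>a' * d' - b' * c'\<bar> = 1"
  shows "moebius a b c d \<circ> moebius a' b' c' d' =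
    moebius (a * a' + b * c') (a * b' + b * d') (c * a' + d * c') (c * b' + d * d')"
    and "\<bar>(a * a' + b * c') * (c * b' + d * d') - (a * b' + b * d') * (c * a' + d * c')\<bar> = 1"
proof -
  have "(a * a' + b * c') * (c * b' + d * d') - (a * b' + b * d') * (c * a' + d * c')
      = (a * d - b * c) * (a' * d' - b' * c')" by (simp add: algebra_simps)
  then show det:
    "\<bar>(a * a' + b * c') * (c * b' + d * d') - (a * b' + b * d') * (c * a' + d * c')\<bar> = 1"
    using assms by (simp add: abs_mult)
  show "moebius a b c d \<circ> moebius a' b' c' d' =
    moebius (a * a' + b * c') (a * b' + b * d') (c * a' + d * c') (c * b' + d * d')"
  proof
    fix r
    obtain x y where xy: "coprime x y" "r = slope x y" using slope_surj by blast
    show "(moebius a b c d \<circ> moebius a' b' c' d') r =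
      moebius (a * a' + b * c') (a * b' + b * d') (c * a' + d * c') (c * b' + d * d') r"
      using xy by (simp add: moebius_slope[OF assms(1) coprime_linear_image[OF assms(2)]]
          moebius_slope[OF assms(2)] moebius_slope[OF det]) (simp add: algebra_simps)
  qed
qed

lemma moebius_one: "\<bar>e\<bar> = 1 \<Longrightarrow> moebius e 0 0 e = id"
proof
  fix r show "\<bar>e\<bar> = 1 \<Longrightarrow> moebius e 0 0 e r = id r" by (cases r) auto
qed

lemma group_ext_modular_group: "group ext_modular_group"
proof (rule groupI)
  fix f g h
  show "\<one>\<^bsub>ext_modular_group\<^esub> \<in> carrier ext_modular_group"
  proof -
    have "id = moebius 1 0 0 1 \<and> \<bar>1 * 1 - 0 * 0 :: int\<bar> = 1" using moebius_one[of 1] by simp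
    then show ?thesis by (simp only: ext_modular_group_def monoid.simps partial_object.simps) blast
  qed
  show "\<one>\<^bsub>ext_modular_group\<^esub> \<otimes>\<^bsub>ext_modular_group\<^esub> f = f"
    "f \<otimes>\<^bsub>ext_modular_group\<^esub> g \<otimes>\<^bsub>ext_modular_group\<^esub> h =
     f \<otimes>\<^bsub>ext_modular_group\<^esub> (g \<otimes>\<^bsub>ext_modular_group\<^esub> h)"
    by (simp_all add: ext_modular_group_def comp_assoc)
  assume "f \<in> carrier ext_modular_group"
  then obtain a b c d where f: "f = moebius a b c d" "\<bar>a * d - b * c\<bar> = 1"
    by (auto simp: ext_modular_group_def)
  have i: "\<bar>d * a - (- b) * (- c)\<bar> = 1" using f by (simp add: mult.commute)
  have "moebius d (- b) (- c) a \<circ> f = id"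
    using moebius_comp(1)[OF i f(2)] moebius_one[OF f(2)] f(1) by (simp add: algebra_simps)
  then have "moebius d (- b) (- c) a \<otimes>\<^bsub>ext_modular_group\<^esub> f = \<one>\<^bsub>ext_modular_group\<^esub>"
    by (simp add: ext_modular_group_def)
  moreover have "moebius d (- b) (- c) a \<in> carrier ext_modular_group"
    unfolding ext_modular_group_def using i by (simp only: partial_object.simps) blast
  ultimately show "\<exists>k\<in>carrier ext_modular_group. k \<otimes>\<^bsub>ext_modular_group\<^esub> f = \<one>\<^bsub>ext_modular_group\<^esub>"
    by blast
  assume "g \<in> carrier ext_modular_group"
  then obtain a' b' c' d' where g: "g = moebius a' b' c' d'" "\<bar>a' * d' - b' * c'\<bar> = 1"
    by (auto simp: ext_modular_group_def)
  show "f \<otimes>\<^bsub>ext_modular_group\<^esub> g \<in> carrier ext_modular_group"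
    using moebius_comp[OF f(2) g(2)] f(1) g(1) unfolding ext_modular_group_def by auto
qed

end

theory Submission imports Defs begin

text \<open>
  Both properties say that \<open>S\<close> acts simply transitively on the projective line.

  A Neumann subgroup is one for which the orbit map \<open>\<alpha> \<mapsto> \<alpha>(\<infinity>)\<close> is a bijection onto the projective
  line, and this map is equivariant. Pull the distant graph back along it. Since elements of \<open>S\<close> are
  graph automorphisms, \<open>\<alpha>\<close> and \<open>\<beta>\<close> become adjacent exactly when \<open>\<alpha>\<^sup>-\<^sup>1\<beta>\<close> sends \<open>\<infinity>\<close> to a neighbour
  of \<open>\<infinity>\<close>, so the pulled-back graph is the Cayley graph for the set of all such elements
  (\<open>ext_modular_group_adjacent_iff\<close>). This set is symmetric because adjacency is, omits the identity
  because the graph has no loops, and generates \<open>S\<close> because the graph is connected. Connectedness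
  (\<open>adjacent_induct\<close>) is the Euclidean algorithm: a fraction \<open>a/c\<close> with \<open>c \<noteq> 0\<close> has a neighbour of
  smaller denominator.

  Conversely, an equivariant bijection from \<open>S\<close> onto the projective line is the orbit map of the
  point that corresponds to the identity. Simple transitivity does not depend on the base point, so
  the orbit map of \<open>\<infinity>\<close> is bijective as well.
\<close>

section \<open>Adjacency of slopes\<close>

definition adjacent :: "rat option \<Rightarrow> rat option \<Rightarrow> bool" where
  "adjacent r s \<longleftrightarrow> {proj_point r, proj_point s} \<in> snd distant_graph"

lemma adjacent_sym: "adjacent r s \<longleftrightarrow> adjacent s r"
  by (simp add: adjacent_def insert_commute)

lemma proj_point_eq_iff [simp]: "proj_point r = proj_point s \<longleftrightarrow> r = s"
  using bij_betw_imp_inj_on[OF bij_betw_proj_point] by (simp add: inj_eq)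

text \<open>
  The definition of the edges leaves open which end is spanned by which vector. This form fixes
  it: exchanging the two vectors only changes the sign of the determinant.
\<close>

lemma adjacentE:
  assumes "adjacent r s"
  obtains a b c d where "coprime a c" "coprime b d" "\<bar>a * d - b * c\<bar> = 1"
    "r = slope a c" "s = slope b d"
proof -
  obtain a b c d where *: "coprime a c" "coprime b d" "\<bar>a * d - b * c\<bar> = 1"
    and "{proj_point r, proj_point s} = {cyclic_submodule (a, c), cyclic_submodule (b, d)}"
    using assms unfolding adjacent_def distant_graph_def by auto
  then have "{proj_point r, proj_point s} = {proj_point (slope a c), proj_point (slope b d)}"
    by (simp add: proj_point_slope)
  then consider "r = slope a c" "s = slope b d" | "r = slope b d" "s = slope a c"
    by (auto simp: doubleton_eq_iff)
  then show thesis
  proof cases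
    case 1
    with * show thesis by (rule that)
  next
    case 2
    have "\<bar>b * c - a * d\<bar> = 1" using *(3) by linarith
    with *(1,2) 2 show thesis by (intro that)
  qed
qed

lemma adjacent_slope:
  assumes "coprime a c" "coprime b d" "\<bar>a * d - b * c\<bar> = 1"
  shows "adjacent (slope a c) (slope b d)"
  using assms unfolding adjacent_def distant_graph_def by (auto simp: proj_point_slope)

lemma not_adjacent_self: "\<not> adjacent r r"
proof
  assume "adjacent r r"
  then obtain a b c d where "coprime a c" "coprime b d" "\<bar>a * d - b * c\<bar> = 1"
    "r = slope a c" "r = slope b d" by (rule adjacentE)
  then show False using slope_eq_iff[of a c b d] by simp
qed

section \<open>Connectedness of the distant graph\<close>

text \<open>One division step of the Euclidean algorithm: \<open>d\<close> is the inverse of \<open>a\<close> modulo \<open>c\<close>.\<close>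

lemma adjacent_smaller_denominator:
  fixes a c :: int
  assumes "coprime a c" "c \<noteq> 0"
  obtains b d where "coprime b d" "\<bar>d\<bar> < \<bar>c\<bar>" "adjacent (slope b d) (slope a c)"
proof -
  obtain u v where uv: "u * a + v * c = 1"
    using bezout_int[of a c] assms(1) by auto
  define d where "d = u mod c"
  define b where "b = - (v + a * (u div c))"
  have d_eq: "d = u - c * (u div c)" by (simp add: d_def minus_mult_div_eq_mod)
  have det: "a * d - b * c = 1" using uv unfolding b_def d_eq by (simp add: algebra_simps)
  have cop: "coprime b d"
  proof (rule coprimeI)
    fix k assume "k dvd b" "k dvd d"
    then have "k dvd a * d - b * c" by simp
    then show "is_unit k" using det by simp
  qed
  have "\<bar>b * c - a * d\<bar> = 1" using det by linarith
  with cop assms show thesis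
    by (intro that[of b d] adjacent_slope) (simp_all add: d_def abs_mod_less)
qed

lemma adjacent_induct:
  assumes base: "P None" and step: "\<And>r s. adjacent r s \<Longrightarrow> P r \<Longrightarrow> P s"
  shows "P s"
proof -
  have "P (slope a c)" if "coprime a c" for a c
    using that
  proof (induction "nat \<bar>c\<bar>" arbitrary: a c rule: less_induct)
    case less
    show ?case
    proof (cases "c = 0")
      case True
      then show ?thesis using base by (simp add: slope_def)
    next
      case False
      with less.prems obtain b d where "coprime b d" "\<bar>d\<bar> < \<bar>c\<bar>" "adjacent (slope b d) (slope a c)"
        by (rule adjacent_smaller_denominator)
      then show ?thesis using less.hyps[of d b] step by simp
    qed
  qed
  then show ?thesis using slope_surj by metis
qed

section \<open>The extended modular group as a group of graph automorphisms\<close>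

lemma ext_modular_group_simps [simp]:
  "f \<otimes>\<^bsub>ext_modular_group\<^esub> g = f \<circ> g" "\<one>\<^bsub>ext_modular_group\<^esub> = id"
  by (simp_all add: ext_modular_group_def)

lemma ext_modular_group_inv_apply:
  assumes "f \<in> carrier ext_modular_group"
  shows "(inv\<^bsub>ext_modular_group\<^esub> f) (f r) = r" "f ((inv\<^bsub>ext_modular_group\<^esub> f) r) = r"
  using group.l_inv[OF group_ext_modular_group assms] group.r_inv[OF group_ext_modular_group assms]
  by (simp_all add: fun_eq_iff)

text \<open>Adjacency is a condition on the determinant of two vectors, and determinants multiply.\<close>

lemma ext_modular_group_adjacent:
  assumes "f \<in> carrier ext_modular_group" "adjacent r s"
  shows "adjacent (f r) (f s)"
proof -
  obtain p q u v where f: "f = moebius p q u v" "\<bar>p * v - q * u\<bar> = 1"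
    using assms(1) by (auto simp: ext_modular_group_def)
  obtain a b c d where *: "coprime a c" "coprime b d" "\<bar>a * d - b * c\<bar> = 1"
    "r = slope a c" "s = slope b d" using assms(2) by (rule adjacentE)
  have "(p * a + q * c) * (u * b + v * d) - (p * b + q * d) * (u * a + v * c)
      = (p * v - q * u) * (a * d - b * c)" by (simp add: algebra_simps)
  then have "\<bar>(p * a + q * c) * (u * b + v * d) - (p * b + q * d) * (u * a + v * c)\<bar> = 1"
    using f(2) *(3) by (simp add: abs_mult)
  then show ?thesis
    unfolding f(1) *(4,5) moebius_slope[OF f(2) *(1)] moebius_slope[OF f(2) *(2)]
    by (intro adjacent_slope coprime_linear_image f(2) *)
qed

lemma ext_modular_group_adjacent_iff:
  assumes "f \<in> carrier ext_modular_group"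
  shows "adjacent ((inv\<^bsub>ext_modular_group\<^esub> f) r) s \<longleftrightarrow> adjacent r (f s)"
  using ext_modular_group_adjacent[of "inv\<^bsub>ext_modular_group\<^esub> f" r "f s"]
    ext_modular_group_adjacent[OF assms, of "(inv\<^bsub>ext_modular_group\<^esub> f) r" s]
    group.inv_closed[OF group_ext_modular_group assms] ext_modular_group_inv_apply[OF assms]
  by auto

lemma vertex_action_proj_point: "vertex_action f (proj_point r) = proj_point (f r)"
  using bij_betw_imp_inj_on[OF bij_betw_proj_point] by (simp add: vertex_action_def)

section \<open>Simply transitive subgroups and Cayley representations\<close>

lemma neumann_subgroup_imp_cayley_representation:
  assumes "neumann_subgroup S"
  shows "cayley_representation S"
proof -
  let ?M = ext_modular_group
  let ?H = "?M\<lparr>carrier := S\<rparr>"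
  have S: "subgroup S ?M" and ex1: "\<And>r. \<exists>!\<alpha>. \<alpha> \<in> S \<and> \<alpha> None = r"
    using assms by (auto simp: neumann_subgroup_def)
  have SM: "\<alpha> \<in> carrier ?M" if "\<alpha> \<in> S" for \<alpha> using that subgroup.mem_carrier[OF S] by blast
  have inv_H: "inv\<^bsub>?H\<^esub> \<alpha> = inv\<^bsub>?M\<^esub> \<alpha>" if "\<alpha> \<in> S" for \<alpha>
    using group.m_inv_consistent[OF group_ext_modular_group S that] by simp
  have inv_S: "inv\<^bsub>?M\<^esub> \<alpha> \<in> S" if "\<alpha> \<in> S" for \<alpha> using subgroup.m_inv_closed[OF S that] .
  have comp_S: "\<alpha> \<circ> \<beta> \<in> S" if "\<alpha> \<in> S" "\<beta> \<in> S" for \<alpha> \<beta>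
    using subgroup.m_closed[OF S that] by simp
  have id_S: "id \<in> S" using subgroup.one_closed[OF S] by simp
  have inv_inv: "inv\<^bsub>?M\<^esub> (inv\<^bsub>?M\<^esub> \<alpha>) = \<alpha>" if "\<alpha> \<in> S" for \<alpha>
    using group.inv_inv[OF group_ext_modular_group SM[OF that]] .
  have inv_comp: "\<alpha> \<circ> (inv\<^bsub>?M\<^esub> \<alpha> \<circ> \<beta>) = \<beta>" if "\<alpha> \<in> S" for \<alpha> \<beta>
    using ext_modular_group_inv_apply(2)[OF SM[OF that]] by (simp add: fun_eq_iff)
  have comp_inv: "inv\<^bsub>?M\<^esub> \<alpha> \<circ> (\<alpha> \<circ> \<beta>) = \<beta>" if "\<alpha> \<in> S" for \<alpha> \<beta>
    using ext_modular_group_inv_apply(1)[OF SM[OF that]] by (simp add: fun_eq_iff)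
  define G where "G = {g \<in> S. adjacent None (g None)}"
  define \<phi> where "\<phi> \<alpha> = proj_point (\<alpha> None)" for \<alpha> :: "rat option \<Rightarrow> rat option"
  have G_iff: "inv\<^bsub>?M\<^esub> \<alpha> \<circ> \<beta> \<in> G \<longleftrightarrow> adjacent (\<alpha> None) (\<beta> None)" if "\<alpha> \<in> S" "\<beta> \<in> S" for \<alpha> \<beta>
    using that comp_S inv_S ext_modular_group_adjacent_iff[OF SM[OF that(1)], of "\<beta> None" None]
    by (simp add: G_def adjacent_sym[of None] adjacent_sym[of "\<beta> None"])
  have "id \<notin> G" using not_adjacent_self by (simp add: G_def)
  then have G_sub: "G \<subseteq> S - {\<one>\<^bsub>?H\<^esub>}" by (auto simp: G_def)
  have G_inv: "inv\<^bsub>?M\<^esub> g \<in> G" if "g \<in> G" for g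
    using that G_iff[of g id] id_S by (simp add: G_def adjacent_sym)
  have "(\<lambda>g. inv\<^bsub>?H\<^esub> g) ` G = (\<lambda>g. inv\<^bsub>?M\<^esub> g) ` G"
    using inv_H by (intro image_cong) (auto simp: G_def)
  also have "\<dots> = G"
  proof
    show "(\<lambda>g. inv\<^bsub>?M\<^esub> g) ` G \<subseteq> G" using G_inv by blast
    show "G \<subseteq> (\<lambda>g. inv\<^bsub>?M\<^esub> g) ` G"
    proof
      fix g assume g: "g \<in> G"
      then have "g = inv\<^bsub>?M\<^esub> (inv\<^bsub>?M\<^esub> g)" using inv_inv by (simp add: G_def)
      then show "g \<in> (\<lambda>g. inv\<^bsub>?M\<^esub> g) ` G" using G_inv[OF g] by (rule image_eqI)
    qed
  qed
  finally have G_sym: "(\<lambda>g. inv\<^bsub>?H\<^esub> g) ` G = G" .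
  have "\<alpha> \<in> generate ?H G" if "\<alpha> \<in> S" "\<alpha> None = r" for \<alpha> r
    using that
  proof (induction r arbitrary: \<alpha> rule: adjacent_induct)
    case 1
    then have "\<alpha> = \<one>\<^bsub>?H\<^esub>" using ex1[of None] id_S by auto
    then show ?case by (simp only: generate.one)
  next
    \<comment> \<open>Walk one edge further: the last edge of the path is the generator \<open>\<beta>\<^sup>-\<^sup>1\<alpha>\<close>.\<close>
    case (2 r s)
    obtain \<beta> where \<beta>: "\<beta> \<in> S" "\<beta> None = r" using ex1[of r] by blast
    have "inv\<^bsub>?M\<^esub> \<beta> \<circ> \<alpha> \<in> G" using 2 \<beta> G_iff by simp
    then have "\<beta> \<otimes>\<^bsub>?H\<^esub> (inv\<^bsub>?M\<^esub> \<beta> \<circ> \<alpha>) \<in> generate ?H G"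
      by (intro generate.eng generate.incl 2(2) \<beta>)
    moreover have "\<beta> \<otimes>\<^bsub>?H\<^esub> (inv\<^bsub>?M\<^esub> \<beta> \<circ> \<alpha>) = \<alpha>" using inv_comp[OF \<beta>(1), of \<alpha>] by simp
    ultimately show ?case by (simp only:)
  qed
  moreover have "generate ?H G \<subseteq> S"
    using group.generate_in_carrier[OF subgroup.subgroup_is_group[OF S group_ext_modular_group], of G]
    by (auto simp: G_def)
  ultimately have gen: "generate ?H G = S" by blast
  have "bij_betw (\<lambda>\<alpha>. \<alpha> None) S UNIV"
    unfolding bij_betw_def inj_on_def using ex1 by (auto simp: image_iff) metis+
  then have bij: "bij_betw \<phi> S projective_line_Z"
    using bij_betw_trans[OF _ bij_betw_proj_point] by (simp add: \<phi>_def[abs_def] comp_def)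
  have edge: "{\<alpha>, \<beta>} \<in> snd (cayley_graph ?H G) \<longleftrightarrow> {\<phi> \<alpha>, \<phi> \<beta>} \<in> snd distant_graph"
    if "\<alpha> \<in> S" "\<beta> \<in> S" for \<alpha> \<beta>
  proof -
    have "{\<alpha>, \<beta>} \<in> snd (cayley_graph ?H G) \<longleftrightarrow> inv\<^bsub>?M\<^esub> \<alpha> \<circ> \<beta> \<in> G \<or> inv\<^bsub>?M\<^esub> \<beta> \<circ> \<alpha> \<in> G"
    proof
      assume "{\<alpha>, \<beta>} \<in> snd (cayley_graph ?H G)"
      then obtain \<gamma> g where \<gamma>: "\<gamma> \<in> S" and "g \<in> G" "{\<alpha>, \<beta>} = {\<gamma>, \<gamma> \<circ> g}"
        by (auto simp: cayley_graph_def)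
      then show "inv\<^bsub>?M\<^esub> \<alpha> \<circ> \<beta> \<in> G \<or> inv\<^bsub>?M\<^esub> \<beta> \<circ> \<alpha> \<in> G"
        using comp_inv[OF \<gamma>, of g] by (auto simp: doubleton_eq_iff)
    next
      have *: "{\<alpha>, \<beta>} \<in> snd (cayley_graph ?H G)" if "\<alpha> \<in> S" "inv\<^bsub>?M\<^esub> \<alpha> \<circ> \<beta> \<in> G" for \<alpha> \<beta>
      proof -
        have "{\<alpha>, \<beta>} = {\<alpha>, \<alpha> \<otimes>\<^bsub>?H\<^esub> (inv\<^bsub>?M\<^esub> \<alpha> \<circ> \<beta>)}" using inv_comp[OF that(1), of \<beta>] by simp
        with that show ?thesis unfolding cayley_graph_def snd_conv by fastforce
      qed
      assume "inv\<^bsub>?M\<^esub> \<alpha> \<circ> \<beta> \<in> G \<or> inv\<^bsub>?M\<^esub> \<beta> \<circ> \<alpha> \<in> G"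
      then show "{\<alpha>, \<beta>} \<in> snd (cayley_graph ?H G)"
        using *[of \<alpha> \<beta>] *[of \<beta> \<alpha>] that by (auto simp: insert_commute)
    qed
    also have "\<dots> \<longleftrightarrow> adjacent (\<alpha> None) (\<beta> None)"
      using G_iff[OF that] G_iff[OF that(2,1)] adjacent_sym by blast
    finally show ?thesis by (simp add: \<phi>_def adjacent_def)
  qed
  have "graph_iso \<phi> (cayley_graph ?H G) distant_graph"
    unfolding graph_iso_def using bij edge by (simp add: cayley_graph_def distant_graph_def)
  moreover have "\<forall>\<alpha>\<in>S. \<forall>\<beta>\<in>S. \<phi> (\<alpha> \<otimes>\<^bsub>?H\<^esub> \<beta>) = vertex_action \<alpha> (\<phi> \<beta>)"
    by (simp add: \<phi>_def vertex_action_proj_point)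
  ultimately show ?thesis
    unfolding cayley_representation_def Let_def using S G_sub G_sym gen by blast
qed

lemma cayley_representation_imp_neumann_subgroup:
  assumes "cayley_representation S"
  shows "neumann_subgroup S"
proof -
  let ?M = ext_modular_group
  have S: "subgroup S ?M" using assms by (simp add: cayley_representation_def)
  obtain \<phi> where bij: "bij_betw \<phi> S projective_line_Z"
    and equiv: "\<And>\<alpha> \<beta>. \<alpha> \<in> S \<Longrightarrow> \<beta> \<in> S \<Longrightarrow> \<phi> (\<alpha> \<circ> \<beta>) = vertex_action \<alpha> (\<phi> \<beta>)"
    using assms unfolding cayley_representation_def Let_def graph_iso_def
    by (auto simp: cayley_graph_def distant_graph_def)
  have id_S: "id \<in> S" using subgroup.one_closed[OF S] by simp
  have line: "range proj_point = projective_line_Z"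
    using bij_betw_imp_surj_on[OF bij_betw_proj_point] .
  obtain r0 where r0: "\<phi> id = proj_point r0"
    using bij_betwE[OF bij] id_S line by blast
  have \<phi>: "\<phi> \<alpha> = proj_point (\<alpha> r0)" if "\<alpha> \<in> S" for \<alpha>
    using equiv[OF that id_S] r0 vertex_action_proj_point by simp
  have surj: "\<exists>\<alpha>\<in>S. \<alpha> r0 = r" for r
  proof -
    have "proj_point r \<in> \<phi> ` S" using bij_betw_imp_surj_on[OF bij] line by blast
    then show ?thesis using \<phi> by auto
  qed
  have inj: "\<alpha> = \<beta>" if "\<alpha> \<in> S" "\<beta> \<in> S" "\<alpha> r0 = \<beta> r0" for \<alpha> \<beta>
    using inj_onD[OF bij_betw_imp_inj_on[OF bij], of \<alpha> \<beta>] that \<phi> by simp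
  \<comment> \<open>Composition with \<open>\<gamma>\<close> on the right moves the base point from \<open>r0\<close> to \<open>\<infinity>\<close>.\<close>
  obtain \<gamma> where \<gamma>: "\<gamma> \<in> S" "\<gamma> r0 = None" using surj by blast
  have \<gamma>_inv: "\<gamma> ((inv\<^bsub>?M\<^esub> \<gamma>) r) = r" "(inv\<^bsub>?M\<^esub> \<gamma>) (\<gamma> r) = r" for r
    using ext_modular_group_inv_apply subgroup.mem_carrier[OF S \<gamma>(1)] by blast+
  have "\<exists>!\<alpha>. \<alpha> \<in> S \<and> \<alpha> None = r" for r
  proof (rule ex_ex1I)
    obtain \<delta> where "\<delta> \<in> S" "\<delta> r0 = r" using surj by blast
    moreover have "(inv\<^bsub>?M\<^esub> \<gamma>) None = r0" using \<gamma>_inv(2)[of r0] \<gamma>(2) by simp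
    ultimately show "\<exists>\<alpha>. \<alpha> \<in> S \<and> \<alpha> None = r"
      using subgroup.m_closed[OF S _ subgroup.m_inv_closed[OF S \<gamma>(1)], of \<delta>]
      by (intro exI[of _ "\<delta> \<circ> inv\<^bsub>?M\<^esub> \<gamma>"]) simp
  next
    fix \<alpha> \<beta> assume *: "\<alpha> \<in> S \<and> \<alpha> None = r" "\<beta> \<in> S \<and> \<beta> None = r"
    then have "\<alpha> \<circ> \<gamma> = \<beta> \<circ> \<gamma>"
      using subgroup.m_closed[OF S _ \<gamma>(1)] \<gamma>(2) by (intro inj) auto
    then show "\<alpha> = \<beta>" using \<gamma>_inv(1) by (metis comp_apply ext)
  qed
  then show ?thesis using S by (simp add: neumann_subgroup_def)
qed

theorem theorem2p2:
  fixes S :: "(rat option \<Rightarrow> rat option) set"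
  assumes "subgroup S ext_modular_group"
  shows "neumann_subgroup S \<longleftrightarrow> cayley_representation S"
  using neumann_subgroup_imp_cayley_representation cayley_representation_imp_neumann_subgroup
  by blast

end
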